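(* Let $X$ be a Banach space and let $P\subseteq X$ be a closed cone. Then $P$ is reflexive if and only if $\widehat{P}=P^{00}$.
   Context: All spaces are real. $B_X$ is the closed unit ball of $X$. A cone of $X$ is a nonempty convex set $P\subseteq X$ with $\lambda P\subseteq P$ for every real $\lambda\ge 0$ (it need not be pointed). A cone $P$ of a Banach space $X$ is reflexive if $P\cap B_X$ is weakly compact. The dual cone of $P$ is $P^0=\{x^*\in X^*: x^*(x)\ge 0 \text{ for each } x\in P\}$, and $P^{00}=(P^0)^0\subseteq X^{**}$ is the dual cone of $P^0$. $\widehat{P}=J_X(P)\subseteq X^{**}$, where $J_X:X\to X^{**}$ is the natural embedding. *)

theory Defs
  imports "HOL-Analysis.Analysis"
begin

(* The dual space of 'a is the type 'a \<Rightarrow>\<^sub>L real of bounded linear functionals, with the operator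
   norm; the bidual is ('a \<Rightarrow>\<^sub>L real) \<Rightarrow>\<^sub>L real. *)

(* "euclidean" on the function type ('a \<Rightarrow>\<^sub>L real) \<Rightarrow> real is the topology of pointwise convergence,
   so this is the initial topology of all bounded linear functionals. *)
definition weak_topology :: "'a::real_normed_vector topology" where
  "weak_topology = pullback_topology UNIV (\<lambda>x (f :: 'a \<Rightarrow>\<^sub>L real). blinfun_apply f x) euclidean"

lemma topspace_weak_topology [simp]: "topspace weak_topology = UNIV"
  by (simp add: weak_topology_def topspace_pullback_topology)

lemma continuous_map_weak_topology_iff:
  "continuous_map T weak_topology g \<longleftrightarrow>
     (\<forall>f :: 'a::real_normed_vector \<Rightarrow>\<^sub>L real. continuous_map T euclidean (\<lambda>y. blinfun_apply f (g y)))"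
proof
  assume g: "continuous_map T weak_topology g"
  show "\<forall>f :: 'a \<Rightarrow>\<^sub>L real. continuous_map T euclidean (\<lambda>y. blinfun_apply f (g y))"
  proof
    fix f :: "'a \<Rightarrow>\<^sub>L real"
    have "continuous_map euclidean euclidean (\<lambda>h :: ('a \<Rightarrow>\<^sub>L real) \<Rightarrow> real. h f)"
      by (simp add: continuous_on_product_coordinates)
    then have "continuous_map weak_topology euclidean ((\<lambda>h. h f) \<circ> (\<lambda>x (f :: 'a \<Rightarrow>\<^sub>L real). blinfun_apply f x))"
      unfolding weak_topology_def by (rule continuous_map_pullback)
    from continuous_map_compose[OF g this]
    show "continuous_map T euclidean (\<lambda>y. blinfun_apply f (g y))"
      by (simp add: o_def)
  qed
next
  assume "\<forall>f :: 'a \<Rightarrow>\<^sub>L real. continuous_map T euclidean (\<lambda>y. blinfun_apply f (g y))"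
  then have "continuous_map T euclidean ((\<lambda>x (f :: 'a \<Rightarrow>\<^sub>L real). blinfun_apply f x) \<circ> g)"
    by (simp add: o_def continuous_map_componentwise_UNIV flip: euclidean_product_topology)
  then show "continuous_map T weak_topology g"
    unfolding weak_topology_def by (rule continuous_map_pullback') simp
qed

definition reflexive_cone :: "'a::real_normed_vector set \<Rightarrow> bool" where
  "reflexive_cone P \<longleftrightarrow> convex_cone P \<and> compactin weak_topology (P \<inter> cball 0 1)"

definition dual_cone :: "'a::real_normed_vector set \<Rightarrow> ('a \<Rightarrow>\<^sub>L real) set" where
  "dual_cone P = {f. \<forall>x\<in>P. blinfun_apply f x \<ge> 0}"

definition bidual_embedding :: "'a::real_normed_vector \<Rightarrow> (('a \<Rightarrow>\<^sub>L real) \<Rightarrow>\<^sub>L real)" where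
  "bidual_embedding x = Blinfun (\<lambda>f. blinfun_apply f x)"

lemma bidual_embedding_apply [simp]:
  "blinfun_apply (bidual_embedding x) f = blinfun_apply f x"
  unfolding bidual_embedding_def
  by (subst bounded_linear_Blinfun_apply) (simp_all add: blinfun.bounded_linear_left)

end

theory Submission
  imports Defs
begin

text \<open>
  Write \<open>B\<close> for the closed unit ball of the space and \<open>J\<close> for the natural embedding. The theorem is
  the cone version of the fact that a Banach space is reflexive iff its unit ball is weakly compact.

  Assume that \<open>P \<inter> B\<close> is weakly compact and let \<open>F\<close> be an element of the second dual cone with
  norm at most 1. The key step is a Goldstine theorem for cones (\<open>dual_cone_bound\<close>): every
  functional \<open>f\<close> satisfies \<open>F f \<le> s\<close>, where \<open>s\<close> is the supremum of \<open>f\<close> on \<open>P \<inter> B\<close>. By homogeneity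
  \<open>f x \<le> s * norm x\<close> on \<open>P\<close>, so the sandwich form of the Hahn-Banach theorem puts a linear \<open>g\<close>
  between them: \<open>f \<le> g\<close> on \<open>P\<close> and \<open>g \<le> s * norm\<close> everywhere. Then \<open>g - f\<close> lies in the dual cone,
  whence \<open>F f \<le> F g \<le> norm g \<le> s\<close>. Moreover, a functional \<open>F\<close> on the dual that is dominated by
  the support function of a weakly compact convex set \<open>K\<close> is evaluation at a point of \<open>K\<close>
  (\<open>representation_on_compact\<close>). For finitely many functionals, the point of \<open>K\<close> whose values are
  nearest to those of \<open>F\<close> in the least squares sense has exactly these values; compactness of
  \<open>K\<close> extends this to all functionals.

  Conversely, assume that \<open>J\<close> maps \<open>P\<close> onto the second dual cone. As \<open>J\<close> is an isometry,
  \<open>P \<inter> B\<close> corresponds to the elements of the second dual cone with norm at most 1. These are cut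
  out of a product of compact intervals by closed conditions, as in the Banach-Alaoglu theorem
  (\<open>compact_positive_functionals\<close>), and the weak topology is the topology of pointwise
  convergence on the dual.
\<close>

section \<open>Sublinear functionals and the sandwich theorem\<close>

definition sublinear :: "('a::real_vector \<Rightarrow> real) \<Rightarrow> bool" where
  "sublinear q \<longleftrightarrow> (\<forall>x y. q (x + y) \<le> q x + q y) \<and> (\<forall>t\<ge>0. \<forall>x. q (t *\<^sub>R x) = t * q x)"

lemma sublinear_add: "sublinear q \<Longrightarrow> q (x + y) \<le> q x + q y"
  by (simp add: sublinear_def)

lemma sublinear_scaleR: "sublinear q \<Longrightarrow> 0 \<le> t \<Longrightarrow> q (t *\<^sub>R x) = t * q x"
  by (simp add: sublinear_def)

lemma sublinear_zero: "sublinear q \<Longrightarrow> q 0 = 0"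
  using sublinear_scaleR[of q 0 0] by simp

lemma sublinear_neg: "sublinear q \<Longrightarrow> - q (- x) \<le> q x"
  using sublinear_add[of q x "- x"] sublinear_zero[of q] by simp

lemma sublinearI:
  assumes add: "\<And>x y. q (x + y) \<le> q x + q y"
    and scale: "\<And>t x. 0 < t \<Longrightarrow> q (t *\<^sub>R x) \<le> t * q x"
    and zero: "q 0 = 0"
  shows "sublinear q"
  unfolding sublinear_def
proof (intro conjI allI impI add)
  fix t :: real and x assume "0 \<le> t"
  show "q (t *\<^sub>R x) = t * q x"
  proof (cases "t = 0")
    case False
    with \<open>0 \<le> t\<close> have t: "0 < t" by simp
    have "q x \<le> inverse t * q (t *\<^sub>R x)"
      using scale[of "inverse t" "t *\<^sub>R x"] t by simp
    then have "t * q x \<le> q (t *\<^sub>R x)"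
      using t by (simp add: field_simps)
    with scale[OF t] show ?thesis by (simp add: antisym)
  qed (simp add: zero)
qed

lemma sublinear_norm: "0 \<le> s \<Longrightarrow> sublinear (\<lambda>x. s * norm x)"
  by (auto simp: sublinear_def norm_triangle_ineq mult_left_mono simp flip: distrib_left)

text \<open>
  The infimal convolution of \<open>q\<close> with \<open>- h\<close> lowers \<open>q\<close> so far that every linear functional below
  the result lies above \<open>h\<close> on \<open>C\<close>: put \<open>x = - y\<close> in the last property. The infimum is finite
  because \<open>h y \<le> q y \<le> q (x + y) + q (- x)\<close>.
\<close>

lemma sublinear_lowering:
  fixes q h :: "'a::real_vector \<Rightarrow> real"
  assumes q: "sublinear q" and C: "convex_cone C"
    and h_add: "\<And>x y. x \<in> C \<Longrightarrow> y \<in> C \<Longrightarrow> h x + h y \<le> h (x + y)"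
    and h_scale: "\<And>t x. 0 \<le> t \<Longrightarrow> x \<in> C \<Longrightarrow> h (t *\<^sub>R x) = t * h x"
    and le: "\<And>x. x \<in> C \<Longrightarrow> h x \<le> q x"
  obtains r where "sublinear r" "\<And>x. r x \<le> q x" "\<And>x y. y \<in> C \<Longrightarrow> r x \<le> q (x + y) - h y"
proof -
  define r where "r x = (INF y\<in>C. q (x + y) - h y)" for x
  have C0: "0 \<in> C" using C by (rule convex_cone_contains_0)
  have h0: "h 0 = 0" using h_scale[of 0 0] C0 by simp
  have below: "- q (- x) \<le> q (x + y) - h y" if "y \<in> C" for x y
    using sublinear_add[OF q, of "x + y" "- x"] le[OF that] by simp
  have lower: "r x \<le> q (x + y) - h y" if "y \<in> C" for x y
    unfolding r_def by (rule cINF_lower[OF bdd_belowI2 that]) (rule below)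
  have greatest: "c \<le> r x" if "\<And>y. y \<in> C \<Longrightarrow> c \<le> q (x + y) - h y" for c x
    unfolding r_def using C0 that by (intro cINF_greatest) auto
  have r_q: "r x \<le> q x" for x
    using lower[OF C0, of x] h0 by simp
  have "sublinear r"
  proof (rule sublinearI)
    fix x1 x2
    have "r (x1 + x2) - r x2 \<le> q (x1 + y1) - h y1" if y1: "y1 \<in> C" for y1
    proof -
      have "r (x1 + x2) - (q (x1 + y1) - h y1) \<le> q (x2 + y2) - h y2" if y2: "y2 \<in> C" for y2
      proof -
        have "r (x1 + x2) \<le> q ((x1 + x2) + (y1 + y2)) - h (y1 + y2)"
          by (intro lower convex_cone_add C y1 y2)
        moreover have "q ((x1 + x2) + (y1 + y2)) \<le> q (x1 + y1) + q (x2 + y2)"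
          using sublinear_add[OF q, of "x1 + y1" "x2 + y2"] by (simp add: algebra_simps)
        ultimately show ?thesis using h_add[OF y1 y2] by linarith
      qed
      from greatest[OF this] show ?thesis by linarith
    qed
    from greatest[OF this] show "r (x1 + x2) \<le> r x1 + r x2" by linarith
  next
    fix t :: real and x assume t: "0 < t"
    have "r (t *\<^sub>R x) / t \<le> q (x + y) - h y" if y: "y \<in> C" for y
    proof -
      have "r (t *\<^sub>R x) \<le> q (t *\<^sub>R x + t *\<^sub>R y) - h (t *\<^sub>R y)"
        using t by (intro lower convex_cone_scaleR C y) simp
      also have "\<dots> = t * (q (x + y) - h y)"
        using t h_scale[of t y] y sublinear_scaleR[OF q, of t "x + y"]
        by (simp add: algebra_simps)
      finally show ?thesis using t by (simp add: field_simps)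
    qed
    from greatest[OF this] show "r (t *\<^sub>R x) \<le> t * r x"
      using t by (simp add: field_simps)
  next
    have "0 \<le> r 0" using below[of _ 0] sublinear_zero[OF q] by (intro greatest) simp
    with r_q[of 0] show "r 0 = 0" using sublinear_zero[OF q] by simp
  qed
  then show ?thesis using r_q lower by (rule that)
qed

lemma convex_cone_ray: "convex_cone {t *\<^sub>R x | t. 0 \<le> t}"
  unfolding convex_cone_iff
proof (intro conjI ballI allI impI)
  show "0 \<in> {t *\<^sub>R x | t. 0 \<le> t}" by (auto intro: exI[of _ 0])
next
  fix a b assume "a \<in> {t *\<^sub>R x | t. 0 \<le> t}" "b \<in> {t *\<^sub>R x | t. 0 \<le> t}"
  then obtain s t where "a = s *\<^sub>R x" "b = t *\<^sub>R x" "0 \<le> s" "0 \<le> t" by auto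
  then have "a + b = (s + t) *\<^sub>R x" "0 \<le> s + t" by (auto simp: scaleR_left_distrib)
  then show "a + b \<in> {t *\<^sub>R x | t. 0 \<le> t}" by blast
next
  fix a and c :: real assume "a \<in> {t *\<^sub>R x | t. 0 \<le> t}" and c: "0 \<le> c"
  then obtain s where "a = s *\<^sub>R x" "0 \<le> s" by auto
  with c have "c *\<^sub>R a = (c * s) *\<^sub>R x" "0 \<le> c * s" by auto
  then show "c *\<^sub>R a \<in> {t *\<^sub>R x | t. 0 \<le> t}" by blast
qed

text \<open>
  If \<open>m\<close> is minimal, then lowering it along the ray through \<open>y\<close>, with \<open>h = m\<close> on that ray, changes
  nothing. The inequality that the lowered functional satisfies is then the missing
  superadditivity \<open>m x + m y \<le> m (x + y)\<close>.
\<close>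

lemma minimal_sublinear_imp_linear:
  fixes m :: "'a::real_vector \<Rightarrow> real"
  assumes m: "sublinear m"
    and min: "\<And>r. sublinear r \<Longrightarrow> (\<And>x. r x \<le> m x) \<Longrightarrow> r = m"
  shows "linear m"
proof -
  have add: "m (x + y) = m x + m y" for x y
  proof -
    obtain r where r: "sublinear r" "\<And>x. r x \<le> m x"
      and r_le: "\<And>x z. z \<in> {t *\<^sub>R y | t. 0 \<le> t} \<Longrightarrow> r x \<le> m (x + z) - m z"
    proof (rule sublinear_lowering[OF m convex_cone_ray[of y], of m])
      fix a b assume "a \<in> {t *\<^sub>R y | t. 0 \<le> t}" "b \<in> {t *\<^sub>R y | t. 0 \<le> t}"
      then obtain s t where "a = s *\<^sub>R y" "b = t *\<^sub>R y" "0 \<le> s" "0 \<le> t" by auto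
      then show "m a + m b \<le> m (a + b)"
        using sublinear_scaleR[OF m] by (simp add: distrib_right flip: scaleR_left_distrib)
    qed (auto simp: sublinear_scaleR[OF m])
    have "y \<in> {t *\<^sub>R y | t. 0 \<le> t}" by (auto intro!: exI[of _ 1])
    from r_le[OF this, of x] min[OF r] have "m x + m y \<le> m (x + y)" by simp
    with sublinear_add[OF m, of x y] show ?thesis by simp
  qed
  have neg: "m (- x) = - m x" for x
    using add[of x "- x"] sublinear_zero[OF m] by simp
  show ?thesis
  proof (rule linearI)
    fix t :: real and x
    show "m (t *\<^sub>R x) = t *\<^sub>R m x"
    proof (cases "0 \<le> t")
      case False
      then have "m (- (t *\<^sub>R x)) = - t * m x"
        using sublinear_scaleR[OF m, of "- t" x] by simp
      then show ?thesis by (simp add: neg)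
    qed (simp add: sublinear_scaleR[OF m])
  qed (rule add)
qed

text \<open>
  Sublinear functionals that are comparable with one \<open>g0\<close> are bounded below at \<open>x\<close> by
  \<open>- g0 (- x)\<close>, so a chain has a finite pointwise infimum. Subadditivity survives because two
  members of the chain can be replaced by the smaller one.
\<close>

lemma sublinear_INF_chain:
  fixes c :: "('a::real_vector \<Rightarrow> real) set"
  assumes ne: "c \<noteq> {}" and sub: "\<And>g. g \<in> c \<Longrightarrow> sublinear g"
    and chain: "\<And>f g. f \<in> c \<Longrightarrow> g \<in> c \<Longrightarrow> f \<le> g \<or> g \<le> f"
  shows "sublinear (\<lambda>x. INF g\<in>c. g x)" and "\<And>g x. g \<in> c \<Longrightarrow> (INF g\<in>c. g x) \<le> g x"
proof -
  define u where "u x = (INF g\<in>c. g x)" for x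
  obtain g0 where g0: "g0 \<in> c" using ne by auto
  have below: "- g0 (- x) \<le> g x" if g: "g \<in> c" for g x
  proof (cases "g \<le> g0")
    case True
    have "- g (- x) \<le> g x" by (rule sublinear_neg[OF sub[OF g]])
    with le_funD[OF True, of "- x"] show ?thesis by linarith
  next
    case False
    then have "g0 \<le> g" using chain[OF g g0] by auto
    with sublinear_neg[OF sub[OF g0], of x] le_funD[OF this, of x] show ?thesis by linarith
  qed
  have lower: "u x \<le> g x" if "g \<in> c" for g x
    unfolding u_def by (rule cINF_lower[OF bdd_belowI2 that]) (rule below)
  then show "(INF g\<in>c. g x) \<le> g x" if "g \<in> c" for g x using that by (simp add: u_def)
  have greatest: "b \<le> u x" if "\<And>g. g \<in> c \<Longrightarrow> b \<le> g x" for b x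
    unfolding u_def using ne that by (intro cINF_greatest) auto
  have "sublinear u"
  proof (rule sublinearI)
    fix x y
    have "u (x + y) - u y \<le> g x" if g: "g \<in> c" for g
    proof -
      have "u (x + y) - g x \<le> f y" if f: "f \<in> c" for f
      proof (cases "f \<le> g")
        case True
        have "u (x + y) \<le> f x + f y"
          using lower[OF f, of "x + y"] sublinear_add[OF sub[OF f], of x y] by linarith
        with le_funD[OF True, of x] show ?thesis by linarith
      next
        case False
        then have "g \<le> f" using chain[OF g f] by auto
        moreover have "u (x + y) \<le> g x + g y"
          using lower[OF g, of "x + y"] sublinear_add[OF sub[OF g], of x y] by linarith
        ultimately show ?thesis using le_funD[of g f y] by linarith
      qed
      then have "u (x + y) - g x \<le> u y" by (rule greatest)
      then show ?thesis by linarith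
    qed
    then have "u (x + y) - u y \<le> u x" by (rule greatest)
    then show "u (x + y) \<le> u x + u y" by linarith
  next
    fix t :: real and x assume t: "0 < t"
    have "u (t *\<^sub>R x) / t \<le> g x" if "g \<in> c" for g
      using lower[OF that, of "t *\<^sub>R x"] sublinear_scaleR[OF sub[OF that], of t x] t
      by (simp add: field_simps)
    from greatest[OF this] show "u (t *\<^sub>R x) \<le> t * u x" using t by (simp add: field_simps)
  next
    show "u 0 = 0"
      using lower[OF g0, of 0] greatest[of 0 0] sublinear_zero[OF sub] g0 by fastforce
  qed
  then show "sublinear (\<lambda>x. INF g\<in>c. g x)" by (simp add: u_def[abs_def])
qed

text \<open>The Hahn-Banach theorem: Zorn's lemma gives a minimal sublinear functional below \<open>q\<close>.\<close>

proposition sublinear_dominates_linear: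
  fixes q :: "'a::real_vector \<Rightarrow> real"
  assumes q: "sublinear q"
  obtains g where "linear g" "\<And>x. g x \<le> q x"
proof -
  define A where "A = {r. sublinear r \<and> r \<le> q}"
  have "\<exists>m\<in>A. \<forall>a\<in>A. a \<le> m \<longrightarrow> a = m"
  proof (rule predicate_Zorn)
    show "partial_order_on A (relation_of (\<lambda>a b. b \<le> a) A)"
      by (rule partial_order_on_relation_ofI) auto
    fix c assume c: "c \<in> Chains (relation_of (\<lambda>a b. b \<le> a) A)"
    then have cA: "c \<subseteq> A" by (rule Chains_relation_of)
    have chain: "f \<le> g \<or> g \<le> f" if "f \<in> c" "g \<in> c" for f g
      using c that by (auto simp: Chains_def relation_of_def)
    show "\<exists>u\<in>A. \<forall>a\<in>c. u \<le> a"
    proof (cases "c = {}")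
      case True
      then show ?thesis using q by (auto simp: A_def)
    next
      case False
      have sub: "sublinear g" if "g \<in> c" for g using that cA by (auto simp: A_def)
      let ?u = "\<lambda>x. INF g\<in>c. g x"
      have u: "sublinear ?u" "\<And>g x. g \<in> c \<Longrightarrow> ?u x \<le> g x"
        using sublinear_INF_chain[OF False sub chain] by blast+
      obtain g where g: "g \<in> c" using False by auto
      then have "?u \<le> g" by (intro le_funI u(2))
      also have "g \<le> q" using g cA by (auto simp: A_def)
      finally show ?thesis using u by (intro bexI[of _ ?u]) (auto simp: A_def le_fun_def)
    qed
  qed
  then obtain m where m: "sublinear m" "m \<le> q" and min: "\<And>a. a \<in> A \<Longrightarrow> a \<le> m \<Longrightarrow> a = m"
    by (auto simp: A_def)
  have "linear m"
  proof (rule minimal_sublinear_imp_linear[OF m(1)])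
    fix r assume "sublinear r" "\<And>x. r x \<le> m x"
    moreover from this have "r \<le> m" by (simp add: le_funI)
    ultimately show "r = m" using m(2) by (intro min) (auto simp: A_def)
  qed
  with m(2) show ?thesis by (intro that) (auto simp: le_fun_def)
qed

proposition sandwich:
  fixes q h :: "'a::real_vector \<Rightarrow> real"
  assumes "sublinear q" and "convex_cone C"
    and "\<And>x y. x \<in> C \<Longrightarrow> y \<in> C \<Longrightarrow> h x + h y \<le> h (x + y)"
    and "\<And>t x. 0 \<le> t \<Longrightarrow> x \<in> C \<Longrightarrow> h (t *\<^sub>R x) = t * h x"
    and "\<And>x. x \<in> C \<Longrightarrow> h x \<le> q x"
  obtains g where "linear g" "\<And>x. g x \<le> q x" "\<And>x. x \<in> C \<Longrightarrow> h x \<le> g x"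
proof -
  obtain r where r: "sublinear r" "\<And>x. r x \<le> q x" "\<And>x y. y \<in> C \<Longrightarrow> r x \<le> q (x + y) - h y"
    using sublinear_lowering[of q C h] assms by blast
  obtain g where g: "linear g" "\<And>x. g x \<le> r x"
    using sublinear_dominates_linear[OF r(1)] by blast
  show ?thesis
  proof (rule that[OF g(1)])
    show "g x \<le> q x" for x using g(2)[of x] r(2)[of x] by linarith
    show "h x \<le> g x" if "x \<in> C" for x
      using g(2)[of "- x"] r(3)[OF that, of "- x"] sublinear_zero[OF assms(1)] linear_neg[OF g(1)]
      by simp
  qed
qed

corollary sandwich_norm:
  fixes h :: "'a::real_normed_vector \<Rightarrow> real"
  assumes s: "0 \<le> s" and "convex_cone C"
    and "\<And>x y. x \<in> C \<Longrightarrow> y \<in> C \<Longrightarrow> h x + h y \<le> h (x + y)"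
    and "\<And>t x. 0 \<le> t \<Longrightarrow> x \<in> C \<Longrightarrow> h (t *\<^sub>R x) = t * h x"
    and "\<And>x. x \<in> C \<Longrightarrow> h x \<le> s * norm x"
  obtains g :: "'a \<Rightarrow>\<^sub>L real" where "norm g \<le> s" "\<And>x. x \<in> C \<Longrightarrow> h x \<le> blinfun_apply g x"
proof -
  obtain g where g: "linear g" "\<And>x. g x \<le> s * norm x" "\<And>x. x \<in> C \<Longrightarrow> h x \<le> g x"
    using sandwich[OF sublinear_norm[OF s] assms(2), of h] assms(3-5) by blast
  have bound: "norm (g x) \<le> s * norm x" for x
    using g(2)[of x] g(2)[of "- x"] linear_neg[OF g(1), of x] by simp
  have "bounded_linear g"
    using g(1) bound by (auto simp: bounded_linear_def bounded_linear_axioms_def mult.commute)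
  then have app: "blinfun_apply (Blinfun g) = g" by (rule bounded_linear_Blinfun_apply)
  show ?thesis
  proof (rule that)
    show "norm (Blinfun g) \<le> s" by (rule norm_blinfun_bound[OF s]) (use bound in \<open>simp add: app\<close>)
  qed (simp add: app g(3))
qed

text \<open>On a ray the norm is additive, so it can be sandwiched with itself there.\<close>

lemma norming_functional:
  fixes x :: "'a::real_normed_vector"
  obtains g :: "'a \<Rightarrow>\<^sub>L real" where "norm g \<le> 1" "norm x \<le> blinfun_apply g x"
proof -
  have add: "norm a + norm b \<le> norm (a + b)"
    if "a \<in> {t *\<^sub>R x | t. 0 \<le> t}" "b \<in> {t *\<^sub>R x | t. 0 \<le> t}" for a b
  proof -
    from that obtain s t where "a = s *\<^sub>R x" "b = t *\<^sub>R x" "0 \<le> s" "0 \<le> t" by auto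
    then show ?thesis by (simp add: distrib_right flip: scaleR_left_distrib)
  qed
  obtain g :: "'a \<Rightarrow>\<^sub>L real" where g: "norm g \<le> 1"
      "\<And>y. y \<in> {t *\<^sub>R x | t. 0 \<le> t} \<Longrightarrow> norm y \<le> blinfun_apply g y"
    using sandwich_norm[of 1 "{t *\<^sub>R x | t. 0 \<le> t}" norm] convex_cone_ray[of x] add by auto
  have "x \<in> {t *\<^sub>R x | t. 0 \<le> t}" by (auto intro!: exI[of _ 1])
  with g that show ?thesis by blast
qed

section \<open>Weak compactness of the unit ball of a cone gives the bidual identity\<close>

text \<open>
  Goldstine's theorem for cones, in support function form. The bound on the unit ball of \<open>P\<close> says
  that \<open>f\<close> is within distance \<open>s\<close> of the negative dual cone: the sandwich theorem yields \<open>g\<close> of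
  norm at most \<open>s\<close> with \<open>g - f\<close> in the dual cone. On such a difference \<open>F\<close> is nonnegative.
\<close>

lemma dual_cone_bound:
  fixes P :: "'a::real_normed_vector set"
  assumes P: "convex_cone P"
    and bound: "\<And>x. x \<in> P \<inter> cball 0 1 \<Longrightarrow> blinfun_apply f x \<le> s"
    and F: "F \<in> dual_cone (dual_cone P)" "norm F \<le> 1"
  shows "blinfun_apply F f \<le> s"
proof -
  have s: "0 \<le> s" using bound[of 0] convex_cone_contains_0[OF P] by (simp add: blinfun.zero_right)
  have le: "blinfun_apply f x \<le> s * norm x" if x: "x \<in> P" for x
  proof (cases "x = 0")
    case False
    have "blinfun_apply f (inverse (norm x) *\<^sub>R x) \<le> s"
      using False convex_cone_scaleR[OF P _ x] by (intro bound) simp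
    then show ?thesis using False by (simp add: blinfun.scaleR_right field_simps)
  qed (simp add: blinfun.zero_right)
  obtain g :: "'a \<Rightarrow>\<^sub>L real" where g: "norm g \<le> s"
      "\<And>x. x \<in> P \<Longrightarrow> blinfun_apply f x \<le> blinfun_apply g x"
    using sandwich_norm[OF s P, of "blinfun_apply f"] le
    by (auto simp: blinfun.add_right blinfun.scaleR_right)
  have "g - f \<in> dual_cone P" using g(2) by (simp add: dual_cone_def blinfun.diff_left)
  then have "blinfun_apply F f \<le> blinfun_apply F g"
    using F(1) by (auto simp: dual_cone_def blinfun.diff_right)
  also have "\<dots> \<le> norm F * norm g" using norm_blinfun[of F g] by simp
  also have "\<dots> \<le> s" using F(2) g(1) s mult_mono[of "norm F" 1 "norm g" s] by simp
  finally show ?thesis .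
qed

lemma continuous_map_weak_blinfun:
  "continuous_map weak_topology euclidean (blinfun_apply (f :: 'a::real_normed_vector \<Rightarrow>\<^sub>L real))"
  using continuous_map_weak_topology_iff[of weak_topology "\<lambda>x :: 'a. x"] by simp

text \<open>
  This is the separation of a point from a compact convex set in Euclidean space, whose
  coordinates are the functionals in \<open>I\<close>, carried out by nearest point projection: the squared
  distance \<open>d\<close> attains its minimum on \<open>K\<close>. Let \<open>a\<close> be the vector of residuals at a minimiser \<open>x\<close>.
  The first order condition says that the combination \<open>w\<close> of the functionals with coefficients
  \<open>a\<close> attains its maximum over \<open>K\<close> at \<open>x\<close>. The hypothesis on \<open>F\<close> then gives \<open>F w \<le> w x\<close>, which
  says that the sum of the squares of the residuals is at most 0.
\<close>

lemma finite_interpolation: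
  fixes K :: "'a::real_normed_vector set" and F :: "('a \<Rightarrow>\<^sub>L real) \<Rightarrow>\<^sub>L real"
  assumes K: "compactin weak_topology K" "convex K" "K \<noteq> {}"
    and F: "\<And>f s. (\<And>x. x \<in> K \<Longrightarrow> blinfun_apply f x \<le> s) \<Longrightarrow> blinfun_apply F f \<le> s"
    and fin: "finite I"
  shows "\<exists>x\<in>K. \<forall>f\<in>I. blinfun_apply f x = blinfun_apply F f"
proof -
  define d where "d x = (\<Sum>f\<in>I. (blinfun_apply f x - blinfun_apply F f)\<^sup>2)" for x
  have "continuous_map weak_topology euclidean d"
    unfolding d_def
    by (intro continuous_map_sum fin continuous_map_real_pow continuous_map_diff
        continuous_map_weak_blinfun) simp
  then have "compact (d ` K)" using image_compactin[OF K(1)] by fastforce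
  then obtain x where x: "x \<in> K" "\<And>y. y \<in> K \<Longrightarrow> d x \<le> d y"
    using compact_attains_inf[of "d ` K"] K(3) by auto
  define a where "a f = blinfun_apply F f - blinfun_apply f x" for f
  define w where "w = (\<Sum>f\<in>I. a f *\<^sub>R f)"
  have w_app: "blinfun_apply w y = (\<Sum>f\<in>I. a f * blinfun_apply f y)" for y
    by (simp add: w_def blinfun.sum_left blinfun.scaleR_left)
  have F_w: "blinfun_apply F w = (\<Sum>f\<in>I. a f * blinfun_apply F f)"
    by (simp add: w_def blinfun.sum_right blinfun.scaleR_right)
  have "blinfun_apply w y \<le> blinfun_apply w x" if y: "y \<in> K" for y
  proof -
    define b where "b f = blinfun_apply f y - blinfun_apply f x" for f :: "'a \<Rightarrow>\<^sub>L real"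
    define B where "B = (\<Sum>f\<in>I. (b f)\<^sup>2)"
    have step: "2 * (\<Sum>f\<in>I. a f * b f) \<le> t * B" if t: "0 < t" "t \<le> 1" for t
    proof -
      define z where "z = (1 - t) *\<^sub>R x + t *\<^sub>R y"
      have "z \<in> K" using K(2) x(1) y t by (auto simp: convex_def z_def)
      then have "d x \<le> d z" by (rule x(2))
      moreover have "d z = d x - 2 * t * (\<Sum>f\<in>I. a f * b f) + t\<^sup>2 * B"
      proof -
        have "blinfun_apply f z - blinfun_apply F f = t * b f - a f" for f
          by (simp add: z_def a_def b_def blinfun.add_right blinfun.diff_right blinfun.scaleR_right
              algebra_simps)
        then have "d z = (\<Sum>f\<in>I. (t * b f - a f)\<^sup>2)" by (simp add: d_def)
        also have "\<dots> = (\<Sum>f\<in>I. (a f)\<^sup>2 - 2 * t * (a f * b f) + t\<^sup>2 * (b f)\<^sup>2)"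
          by (simp add: power2_eq_square algebra_simps)
        also have "\<dots> = (\<Sum>f\<in>I. (a f)\<^sup>2) - 2 * t * (\<Sum>f\<in>I. a f * b f) + t\<^sup>2 * B"
          by (simp add: B_def sum.distrib sum_subtractf sum_distrib_left)
        finally show ?thesis by (simp add: d_def a_def power2_commute)
      qed
      ultimately have "t * (2 * (\<Sum>f\<in>I. a f * b f)) \<le> t * (t * B)"
        by (simp add: power2_eq_square algebra_simps)
      with t show ?thesis by simp
    qed
    \<comment> \<open>let the step length \<open>t = 1 / (n + 1)\<close> tend to 0\<close>
    have le: "2 * (\<Sum>f\<in>I. a f * b f) \<le> B / real (Suc n)" for n
      using step[of "1 / real (Suc n)"] by simp
    have "(\<lambda>n. B / real (Suc n)) \<longlonglongrightarrow> 0"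
      by (intro LIMSEQ_Suc lim_const_over_n)
    then have "2 * (\<Sum>f\<in>I. a f * b f) \<le> 0"
      by (rule LIMSEQ_le_const) (use le in auto)
    then show ?thesis by (simp add: w_app b_def right_diff_distrib sum_subtractf)
  qed
  from F[OF this] have "(\<Sum>f\<in>I. (a f)\<^sup>2) \<le> 0"
    unfolding F_w w_app a_def
    by (simp add: power2_eq_square right_diff_distrib sum_subtractf)
  then have "\<forall>f\<in>I. a f = 0"
    using fin by (simp add: antisym_conv sum_nonneg sum_nonneg_eq_0_iff)
  with x(1) show ?thesis by (auto simp: a_def)
qed

text \<open>
  The points of \<open>K\<close> at which a given functional has the value prescribed by \<open>F\<close> form a weakly
  closed set, and the previous lemma is the finite intersection property of these sets.
\<close>

lemma representation_on_compact:
  fixes K :: "'a::real_normed_vector set" and F :: "('a \<Rightarrow>\<^sub>L real) \<Rightarrow>\<^sub>L real"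
  assumes K: "compactin weak_topology K" "convex K" "K \<noteq> {}"
    and F: "\<And>f s. (\<And>x. x \<in> K \<Longrightarrow> blinfun_apply f x \<le> s) \<Longrightarrow> blinfun_apply F f \<le> s"
  shows "F \<in> bidual_embedding ` K"
proof -
  define H where "H f = {x :: 'a. blinfun_apply f x = blinfun_apply F f}" for f
  have "closedin weak_topology (H f)" for f
    using closedin_continuous_map_preimage[OF continuous_map_weak_blinfun[of f], of "{blinfun_apply F f}"]
    by (simp add: H_def)
  moreover have "K \<inter> \<Inter>\<F> \<noteq> {}" if fin: "finite \<F>" and sub: "\<F> \<subseteq> range H" for \<F>
  proof -
    obtain I where I: "finite I" "\<F> = H ` I" using finite_subset_image[OF fin sub] by blast
    with finite_interpolation[OF K F I(1)] show ?thesis by (auto simp: H_def)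
  qed
  ultimately have "K \<inter> \<Inter>(range H) \<noteq> {}"
    using K(1) unfolding compactin_fip by blast
  then obtain x where "x \<in> K" "\<And>f. blinfun_apply f x = blinfun_apply F f"
    by (auto simp: H_def)
  then show ?thesis by (intro image_eqI[of _ _ x] blinfun_eqI) auto
qed

lemma bidual_embedding_scaleR: "bidual_embedding (t *\<^sub>R x) = t *\<^sub>R bidual_embedding x"
  by (intro blinfun_eqI) (simp add: blinfun.scaleR_left blinfun.scaleR_right)

lemma bidual_embedding_dual_cone:
  "x \<in> P \<Longrightarrow> bidual_embedding x \<in> dual_cone (dual_cone P)"
  by (auto simp: dual_cone_def)

lemma reflexive_cone_imp_bidual:
  fixes P :: "'a::real_normed_vector set"
  assumes "reflexive_cone P"
  shows "bidual_embedding ` P = dual_cone (dual_cone P)"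
proof (intro subset_antisym subsetI)
  have P: "convex_cone P" and comp: "compactin weak_topology (P \<inter> cball 0 1)"
    using assms by (auto simp: reflexive_cone_def)
  have P0: "0 \<in> P" using P by (rule convex_cone_contains_0)
  have conv: "convex (P \<inter> cball 0 1)"
    using P by (intro convex_Int) (auto simp: convex_cone_def)
  fix F assume F: "F \<in> dual_cone (dual_cone P)"
  \<comment> \<open>dividing by \<open>norm F + 1\<close> brings \<open>F\<close> into the unit ball also when \<open>F = 0\<close>\<close>
  define r where "r = norm F + 1"
  have r: "0 < r" by (simp add: r_def add_nonneg_pos)
  have "inverse r *\<^sub>R F \<in> bidual_embedding ` (P \<inter> cball 0 1)"
  proof (rule representation_on_compact[OF comp conv])
    show "P \<inter> cball 0 1 \<noteq> {}" using P0 by auto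
    have "inverse r *\<^sub>R F \<in> dual_cone (dual_cone P)"
      using F r by (auto simp: dual_cone_def blinfun.scaleR_left)
    moreover have "norm (inverse r *\<^sub>R F) \<le> 1"
      using r by (simp add: r_def field_simps)
    ultimately show "blinfun_apply (inverse r *\<^sub>R F) f \<le> s"
      if "\<And>x. x \<in> P \<inter> cball 0 1 \<Longrightarrow> blinfun_apply f x \<le> s" for f s
      using dual_cone_bound[OF P that] by blast
  qed
  then obtain x where x: "x \<in> P" "inverse r *\<^sub>R F = bidual_embedding x" by auto
  have "F = bidual_embedding (r *\<^sub>R x)"
    using r by (simp add: bidual_embedding_scaleR flip: x(2))
  with convex_cone_scaleR[OF P _ x(1), of r] r show "F \<in> bidual_embedding ` P" by auto
qed (auto intro: bidual_embedding_dual_cone)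

section \<open>The bidual identity gives weak compactness\<close>

lemma compactin_pullback_topology:
  assumes "compactin T (f ` S)" and "S \<subseteq> A"
  shows "compactin (pullback_topology A f T) S"
  unfolding compactin_def
proof (intro conjI allI impI)
  show "S \<subseteq> topspace (pullback_topology A f T)"
    using assms compactin_subset_topspace by (fastforce simp: topspace_pullback_topology)
next
  fix \<U> assume U: "Ball \<U> (openin (pullback_topology A f T)) \<and> S \<subseteq> \<Union>\<U>"
  let ?V = "{V. openin T V \<and> f -` V \<inter> A \<in> \<U>}"
  have "f ` S \<subseteq> \<Union>?V"
  proof
    fix y assume "y \<in> f ` S"
    then obtain x where x: "x \<in> S" "y = f x" by auto
    then obtain W where "W \<in> \<U>" "x \<in> W" using U by auto
    moreover from this obtain V where "openin T V" "W = f -` V \<inter> A"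
      using U by (auto simp: openin_pullback_topology)
    ultimately show "y \<in> \<Union>?V" using x by auto
  qed
  then obtain \<F> where F: "finite \<F>" "\<F> \<subseteq> ?V" "f ` S \<subseteq> \<Union>\<F>"
    using assms(1) unfolding compactin_def by (metis (no_types, lifting) mem_Collect_eq)
  then show "\<exists>\<F>. finite \<F> \<and> \<F> \<subseteq> \<U> \<and> S \<subseteq> \<Union>\<F>"
    using assms(2) by (intro exI[of _ "(\<lambda>V. f -` V \<inter> A) ` \<F>"]) (auto 0 3)
qed

lemma norm_le_iff_functionals:
  fixes x :: "'a::real_normed_vector"
  shows "norm x \<le> 1 \<longleftrightarrow> (\<forall>f :: 'a \<Rightarrow>\<^sub>L real. \<bar>blinfun_apply f x\<bar> \<le> norm f)"
proof
  assume x: "norm x \<le> 1"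
  show "\<forall>f :: 'a \<Rightarrow>\<^sub>L real. \<bar>blinfun_apply f x\<bar> \<le> norm f"
  proof
    fix f :: "'a \<Rightarrow>\<^sub>L real"
    have "\<bar>blinfun_apply f x\<bar> \<le> norm f * norm x" using norm_blinfun[of f x] by simp
    also have "\<dots> \<le> norm f" using x by (simp add: mult_left_le)
    finally show "\<bar>blinfun_apply f x\<bar> \<le> norm f" .
  qed
next
  assume *: "\<forall>f :: 'a \<Rightarrow>\<^sub>L real. \<bar>blinfun_apply f x\<bar> \<le> norm f"
  obtain g :: "'a \<Rightarrow>\<^sub>L real" where "norm g \<le> 1" "norm x \<le> blinfun_apply g x"
    by (rule norming_functional)
  with *[rule_format, of g] show "norm x \<le> 1" by linarith
qed

text \<open>
  Banach-Alaoglu for the functionals that are nonnegative on \<open>Q\<close>: each of the conditions of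
  linearity and positivity involves finitely many coordinates, hence is closed in the product of
  the intervals \<open>{- norm f .. norm f}\<close>, which is compact by Tychonoff's theorem.
\<close>

lemma compact_positive_functionals:
  fixes Q :: "'b::real_normed_vector set"
  shows "compact {\<phi>. linear \<phi> \<and> (\<forall>f. \<bar>\<phi> f\<bar> \<le> norm f) \<and> (\<forall>f\<in>Q. 0 \<le> \<phi> f)}"
    (is "compact ?S")
proof -
  let ?box = "PiE UNIV (\<lambda>f :: 'b. {- norm f .. norm f})"
  have "compactin (product_topology (\<lambda>f :: 'b. euclidean :: real topology) UNIV) ?box"
    unfolding compactin_PiE by simp
  then have box: "compact ?box" by (simp add: euclidean_product_topology)
  have S: "?S = ?box \<inter> ((\<Inter>f. \<Inter>g. {\<phi>. \<phi> (f + g) = \<phi> f + \<phi> g}) \<inter>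
      (\<Inter>t. \<Inter>f. {\<phi>. \<phi> (t *\<^sub>R f) = t * \<phi> f}) \<inter> (\<Inter>f\<in>Q. {\<phi>. 0 \<le> \<phi> f}))"
    by (auto simp: linear_iff PiE_def Pi_def abs_le_iff minus_le_iff)
  show ?thesis
    unfolding S
    by (intro compact_Int_closed box closed_Int closed_INT ballI closed_Collect_eq closed_Collect_le
        continuous_intros) simp_all
qed

text \<open>
  Every functional \<open>\<phi>\<close> in the compact set of the previous lemma, taken for the dual cone,
  belongs to the second dual cone, and so by assumption is evaluation at a point of \<open>P\<close>; the norming functional shows that
  this point has norm at most 1.
\<close>

lemma bidual_imp_compactin:
  fixes P :: "'a::real_normed_vector set"
  assumes eq: "bidual_embedding ` P = dual_cone (dual_cone P)"
  shows "compactin weak_topology (P \<inter> cball 0 1)"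
proof -
  let ?ev = "\<lambda>x (f :: 'a \<Rightarrow>\<^sub>L real). blinfun_apply f x"
  have "?ev ` (P \<inter> cball 0 1) =
      {\<phi>. linear \<phi> \<and> (\<forall>f. \<bar>\<phi> f\<bar> \<le> norm f) \<and> (\<forall>f\<in>dual_cone P. 0 \<le> \<phi> f)}" (is "_ = ?S")
  proof (intro subset_antisym subsetI)
    fix \<phi> assume "\<phi> \<in> ?ev ` (P \<inter> cball 0 1)"
    then show "\<phi> \<in> ?S"
      by (auto simp: dual_cone_def norm_le_iff_functionals intro!: bounded_linear.linear blinfun.bounded_linear_left)
  next
    fix \<phi> assume \<phi>: "\<phi> \<in> ?S"
    then have "bounded_linear \<phi>"
      by (auto simp: bounded_linear_def bounded_linear_axioms_def intro!: exI[of _ 1])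
    then have app: "blinfun_apply (Blinfun \<phi>) = \<phi>" by (rule bounded_linear_Blinfun_apply)
    with \<phi> have "Blinfun \<phi> \<in> bidual_embedding ` P"
      unfolding eq by (simp add: dual_cone_def[of "dual_cone P"])
    then obtain x where x: "x \<in> P" "Blinfun \<phi> = bidual_embedding x" by auto
    have \<phi>_eq: "\<phi> = ?ev x" using app x(2) by (auto simp: fun_eq_iff)
    with \<phi> have "norm x \<le> 1" by (simp add: norm_le_iff_functionals)
    with x(1) \<phi>_eq show "\<phi> \<in> ?ev ` (P \<inter> cball 0 1)" by auto
  qed
  then have "compactin euclidean (?ev ` (P \<inter> cball 0 1))"
    by (simp add: compact_positive_functionals)
  then show ?thesis unfolding weak_topology_def by (rule compactin_pullback_topology) simp
qed

theorem theorem3p3: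
  fixes P :: "'a::banach set"
  assumes "convex_cone P" and "closed P"
  shows "reflexive_cone P \<longleftrightarrow> bidual_embedding ` P = dual_cone (dual_cone P)"
  using assms(1) reflexive_cone_imp_bidual[of P] bidual_imp_compactin[of P]
  by (auto simp: reflexive_cone_def)

end
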